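(* Let $\Gamma$ be a finite, folded, symmetric family of Boolean promise relations. Assume there exist odd positive integers $L_1,\dots,L_6$ such that none of $\operatorname{Par}_{L_1}$, $\operatorname{AT}_{L_2}$, $\operatorname{Maj}_{L_3}$, $\overline{\operatorname{Par}}_{L_4}$, $\overline{\operatorname{AT}}_{L_5}$, $\overline{\operatorname{Maj}}_{L_6}$ is a weak polymorphism of $\Gamma$. Then there exists a constant $C=C(\Gamma)$ such that every weak polymorphism of $\Gamma$ is $C$-fixing.
   Context: Domain $\{0,1\}$. A promise relation is a pair $(P,Q)$ with $P\subseteq Q\subseteq\{0,1\}^k$. $f:\{0,1\}^L\to\{0,1\}$ is a weak polymorphism of $(P,Q)$ if for all $x^{(1)},\dots,x^{(L)}\in P$, $(f(x^{(1)}_1,\dots,x^{(L)}_1),\dots,f(x^{(1)}_k,\dots,x^{(L)}_k))\in Q$; of $\Gamma$ if of every member. $f$ is folded if $f(\bar x)=\neg f(x)$ for all $x$; $\Gamma$ is folded if all its weak polymorphisms are folded. $\Gamma$ is symmetric if every relation $P,Q$ appearing in it is invariant under permutations of coordinates. For odd $L$: $\operatorname{Par}_L(x)=\bigoplus_i x_i$, $\operatorname{Maj}_L(x)=1$ iff $\sum_ix_i>L/2$, $\operatorname{AT}_L(x)=1$ iff $\sum_{i=1}^L(-1)^{i-1}x_i>0$; overlines denote negations. A folded function $f:\{0,1\}^L\to\{0,1\}$ is $C$-fixing if there exists $S\subseteq\{1,\dots,L\}$ with $|S|\le C$ such that every $x\in\{0,1\}^L$ with $x_i=0$ for all $i\in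 S$ satisfies $f(x)=f(0,\dots,0)$. *)

theory Defs
  imports Main "HOL-Combinatorics.Permutations"
begin

text \<open>Boolean domain {0,1} is rendered as bool (False = 0, True = 1).
  Tuples in {0,1}^k are bool lists of length k, coordinates indexed 0..k-1.
  A promise relation is a triple (k, P, Q) with P \<subseteq> Q \<subseteq> {0,1}^k.
  A function {0,1}^L \<rightarrow> {0,1} is a function on bool lists; only its values
  on lists of length L matter.\<close>

type_synonym prel = "nat \<times> bool list set \<times> bool list set"

definition promise_rel :: "prel \<Rightarrow> bool" where
  "promise_rel R = (case R of (k, P, Q) \<Rightarrow> P \<subseteq> Q \<and> Q \<subseteq> {x. length x = k})"

definition weak_pol :: "nat \<Rightarrow> (bool list \<Rightarrow> bool) \<Rightarrow> prel \<Rightarrow> bool" where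
  "weak_pol L f R = (case R of (k, P, Q) \<Rightarrow>
     (\<forall>xs. length xs = L \<and> set xs \<subseteq> P \<longrightarrow>
        map (\<lambda>j. f (map (\<lambda>x. x ! j) xs)) [0..<k] \<in> Q))"

definition weak_pol_fam :: "nat \<Rightarrow> (bool list \<Rightarrow> bool) \<Rightarrow> prel set \<Rightarrow> bool" where
  "weak_pol_fam L f \<Gamma> = (\<forall>R\<in>\<Gamma>. weak_pol L f R)"

definition folded_fun :: "nat \<Rightarrow> (bool list \<Rightarrow> bool) \<Rightarrow> bool" where
  "folded_fun L f = (\<forall>x. length x = L \<longrightarrow> f (map Not x) = (\<not> f x))"

definition folded_fam :: "prel set \<Rightarrow> bool" where
  "folded_fam \<Gamma> = (\<forall>L f. L \<ge> 1 \<longrightarrow> weak_pol_fam L f \<Gamma> \<longrightarrow> folded_fun L f)"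

definition perm_invariant :: "nat \<Rightarrow> bool list set \<Rightarrow> bool" where
  "perm_invariant k P = (\<forall>x\<in>P. \<forall>\<sigma>. \<sigma> permutes {0..<k} \<longrightarrow> map (\<lambda>i. x ! \<sigma> i) [0..<k] \<in> P)"

definition symmetric_fam :: "prel set \<Rightarrow> bool" where
  "symmetric_fam \<Gamma> = (\<forall>(k, P, Q)\<in>\<Gamma>. perm_invariant k P \<and> perm_invariant k Q)"

definition Par :: "bool list \<Rightarrow> bool" where
  "Par x = odd (length (filter id x))"

definition Maj :: "bool list \<Rightarrow> bool" where
  "Maj x = (2 * length (filter id x) > length x)"

text \<open>AT(x) = 1 iff sum_{i=1}^L (-1)^(i-1) x_i > 0; with 0-based index i this is (-1)^i.\<close>
definition AT :: "bool list \<Rightarrow> bool" where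
  "AT x = ((\<Sum>i<length x. (-1::int) ^ i * of_bool (x ! i)) > 0)"

definition fixing :: "nat \<Rightarrow> nat \<Rightarrow> (bool list \<Rightarrow> bool) \<Rightarrow> bool" where
  "fixing C L f = (folded_fun L f \<and>
     (\<exists>S. S \<subseteq> {0..<L} \<and> card S \<le> C \<and>
        (\<forall>x. length x = L \<and> (\<forall>i\<in>S. x ! i = False) \<longrightarrow> f x = f (replicate L False))))"

end

theory Submission
  imports Defs
begin

text \<open>
  Identify a weak polymorphism f (up to the sign f(0)) with a self-dual family F of subsets of
  {0..<L}. By symmetry only Hamming weights matter, so a failure of Par, AT or Maj at one promise
  relation yields an arity k, a set A of admissible row weights and a single forbidden output
  weight w, and F must avoid w as well.

  A minimal true set with at least k elements makes f behave like a majority, so a failure of Maj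
  bounds the size of minimal true sets. Given many disjoint true sets, a failure of AT provides a
  number g such that adding g of these sets to a union flips its value and adding g - 1 of them
  keeps a true union true; arithmetic modulo 2 g then shows that f is the parity function on small
  unions, which a failure of Par excludes. So there are boundedly many disjoint true sets, and the
  union of a maximal disjoint family of minimal true sets is a fixing set.
\<close>

section \<open>Set families and forbidden output weights\<close>

text \<open>A list of k sets encodes the columns of a matrix whose rows are indexed by the elements;
  A constrains the row weights.\<close>
definition avoids :: "('a set \<Rightarrow> bool) \<Rightarrow> nat \<Rightarrow> nat set \<Rightarrow> nat \<Rightarrow> bool" where
  "avoids F k A w \<longleftrightarrow> (\<forall>Ts. length Ts = k \<and> (\<forall>i. length (filter (\<lambda>T. i \<in> T) Ts) \<in> A)
     \<longrightarrow> length (filter F Ts) \<noteq> w)"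

definition self_dual :: "('a set \<Rightarrow> bool) \<Rightarrow> bool" where
  "self_dual F \<longleftrightarrow> (\<forall>X. F (- X) = (\<not> F X))"

text \<open>The same kind of pattern with an explicit witness: on an odd number of admissible rows,
  \<open>g\<close> does output the weight that polymorphisms avoid. Rows are listed here, columns in
  \<open>avoids\<close>.\<close>

definition realizes :: "(bool list \<Rightarrow> bool) \<Rightarrow> nat \<Rightarrow> nat set \<Rightarrow> nat \<Rightarrow> bool" where
  "realizes g k A w \<longleftrightarrow> (\<exists>xs. odd (length xs) \<and>
     (\<forall>x\<in>set xs. length x = k \<and> length (filter id x) \<in> A) \<and>
     w = length (filter (\<lambda>j. g (map (\<lambda>x. x ! j) xs)) [0..<k]))"

lemma avoidsD:
  assumes "avoids F k A w" "length Ts = k" "\<And>i. length (filter (\<lambda>T. i \<in> T) Ts) \<in> A"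
  shows "length (filter F Ts) \<noteq> w"
  using assms unfolding avoids_def by blast

text \<open>Pulling the columns back along \<open>h\<close> gives \<open>x\<close> the row of
  \<open>h x\<close>, so row weights stay in \<open>A\<close>. This later allows disjoint true sets
  to be collapsed to singletons.\<close>

lemma avoids_vimage:
  fixes h :: "'a \<Rightarrow> 'b"
  assumes "avoids F k A w"
  shows "avoids (\<lambda>Y. F (h -` Y)) k A w"
  unfolding avoids_def
proof (intro allI impI, elim conjE)
  fix Ts :: "'b set list"
  assume Ts: "length Ts = k" "\<forall>i. length (filter (\<lambda>T. i \<in> T) Ts) \<in> A"
  have "length (filter F (map (\<lambda>Y. h -` Y) Ts)) \<noteq> w"
    by (rule avoidsD[OF assms]) (use Ts in \<open>simp_all add: filter_map o_def\<close>)
  then show "length (filter (\<lambda>Y. F (h -` Y)) Ts) \<noteq> w"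
    by (simp add: filter_map o_def)
qed

text \<open>Complementing every column turns row weight \<open>a\<close> into \<open>k - a\<close>
  and, by self-duality, output weight \<open>w\<close> into \<open>k - w\<close>. Mirror-image cases
  need to be treated only once.\<close>

lemma avoids_dual:
  fixes F :: "'a set \<Rightarrow> bool"
  assumes "avoids F k A w" "self_dual F" "A \<subseteq> {..k}" "w \<le> k"
  shows "avoids F k ((-) k ` A) (k - w)"
  unfolding avoids_def
proof (intro allI impI, elim conjE)
  fix Ts :: "'a set list"
  assume Ts: "length Ts = k" "\<forall>i. length (filter (\<lambda>T. i \<in> T) Ts) \<in> (-) k ` A"
  have neg: "length (filter (\<lambda>T. \<not> p T) Ts) = k - length (filter p Ts)" for p
    using sum_length_filter_compl[of p Ts] Ts(1) by simp
  have "length (filter F (map uminus Ts)) \<noteq> w"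
  proof (rule avoidsD[OF assms(1)])
    fix i
    obtain a where "a \<in> A" "length (filter (\<lambda>T. i \<in> T) Ts) = k - a"
      using Ts(2) by blast
    then show "length (filter (\<lambda>T. i \<in> T) (map uminus Ts)) \<in> A"
      using assms(3) by (auto simp: filter_map o_def neg)
  qed (use Ts in simp)
  then show "length (filter F Ts) \<noteq> k - w"
    using assms(2,4) by (auto simp: filter_map o_def neg self_dual_def)
qed

text \<open>With \<open>w\<close> full columns and all others empty, every row and the output have
  weight \<open>w\<close>.\<close>

lemma avoids_notin:
  assumes "avoids F k A w" "self_dual F" "\<not> F {}" "w \<le> k"
  shows "w \<notin> A"
proof
  assume "w \<in> A"
  have "F UNIV" using assms(2,3) unfolding self_dual_def by (metis Compl_empty_eq)
  have "length (filter F (replicate w UNIV @ replicate (k - w) {})) \<noteq> w"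
    by (rule avoidsD[OF assms(1)]) (use \<open>w \<in> A\<close> assms(4) in simp_all)
  then show False using \<open>F UNIV\<close> assms(3) by simp
qed

lemma length_filter_upt: "length (filter p [0..<k]) = card {j. j < k \<and> p j}"
  by (simp add: length_filter_conv_card cong: conj_cong)

lemma avoids_familyD:
  assumes "avoids F k A w" "\<And>i. card {j. j < k \<and> i \<in> T j} \<in> A"
  shows "card {j. j < k \<and> F (T j)} \<noteq> w"
  using avoidsD[OF assms(1), of "map T [0..<k]"] assms(2)
  by (simp add: filter_map o_def length_filter_upt)

subsection \<open>Failure of majority bounds the minimal true sets\<close>

text \<open>Up to duality, every failure of \<open>Maj\<close> has one of these two shapes, by
  \<open>maj_bad_of_realizes\<close>. Both can be matched by sliding windows on a large minimal true
  set.\<close>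

definition maj_bad :: "nat set \<Rightarrow> nat \<Rightarrow> bool" where
  "maj_bad A w \<longleftrightarrow> (\<exists>a\<in>A. \<exists>b\<in>A. 0 < a \<and> a < w \<and> w < b) \<or> (\<exists>b\<in>A. b < w \<and> w < 2 * b)"

definition minimal_true :: "('a set \<Rightarrow> bool) \<Rightarrow> 'a set \<Rightarrow> bool" where
  "minimal_true F T \<longleftrightarrow> F T \<and> (\<forall>X. X \<subset> T \<longrightarrow> \<not> F X)"

lemma Collect_less_and: "{j::nat. j < k \<and> j < b} = {..<min k b}"
  by auto

text \<open>The only true subset of \<open>T\<close> is \<open>T\<close> itself, so with 0 outside,
  \<open>F\<close> acts on \<open>T\<close> as a conjunction; by self-duality, with 1 outside it
  acts as a disjunction.\<close>

lemma minimal_true_threshold: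
  assumes "self_dual F" "minimal_true F T"
  shows "F {x. if x \<in> T then p x else q} \<longleftrightarrow> (if q then \<exists>x\<in>T. p x else \<forall>x\<in>T. p x)"
proof -
  have sub: "F X \<longleftrightarrow> X = T" if "X \<subseteq> T" for X
    using that assms(2) unfolding minimal_true_def by blast
  show ?thesis
  proof (cases q)
    case True
    have "F {x. if x \<in> T then p x else q} = (\<not> F (- {x. if x \<in> T then p x else q}))"
      using assms(1) by (simp add: self_dual_def)
    also have "- {x. if x \<in> T then p x else q} = {x \<in> T. \<not> p x}"
      using True by auto
    also have "F {x \<in> T. \<not> p x} \<longleftrightarrow> {x \<in> T. \<not> p x} = T" by (rule sub) auto
    finally show ?thesis using True by auto
  next
    case False
    then have "{x. if x \<in> T then p x else q} = {x \<in> T. p x}" by auto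
    moreover have "F {x \<in> T. p x} \<longleftrightarrow> {x \<in> T. p x} = T" by (rule sub) auto
    ultimately show ?thesis using False by auto
  qed
qed

lemma sliding_window:
  fixes i a s j :: nat
  assumes "0 < a"
  shows "(\<exists>i<Suc s. min i s \<le> j \<and> j < min i s + a) \<longleftrightarrow> j < s + a"
  using assms by (auto intro!: exI[of _ "min j s"])

text \<open>Otherwise a matrix whose output is exactly the first \<open>w\<close> columns exists:
  rows outside \<open>T\<close> are the initial segment of length \<open>b\<close>, which switches
  \<open>F\<close> from disjunction to conjunction at column \<open>b\<close>, and rows in
  \<open>T\<close> use shifted windows.\<close>

lemma card_minimal_true:
  assumes F: "self_dual F" "minimal_true F T" and fin: "finite T"
    and av: "avoids F k A w" and A: "A \<subseteq> {..k}" "w \<le> k" and bad: "maj_bad A w"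
  shows "card T < k"
proof (rule ccontr)
  assume "\<not> card T < k"
  have "0 < k" using A bad by (auto simp: maj_bad_def)
  then have ne: "T \<noteq> {}" using \<open>\<not> card T < k\<close> by auto
  obtain h where h: "bij_betw h T {0..<card T}" using ex_bij_betw_finite_nat[OF fin] by blast
  \<comment> \<open>Since \<open>T\<close> has at least \<open>k\<close> elements, every shift from
    0 to \<open>s\<close> occurs, and the windows together cover exactly the first
    \<open>s + a\<close> columns.\<close>
  have win: "(\<exists>x\<in>T. min (h x) s \<le> j \<and> j < min (h x) s + a) \<longleftrightarrow> j < s + a"
    if "0 < a" "s < k" for j s a
  proof -
    have "{0..<Suc s} \<subseteq> h ` T" using h that \<open>\<not> card T < k\<close> by (auto simp: bij_betw_def)
    then show ?thesis
      using sliding_window[OF that(1), of s j]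
      by (smt (verit, best) add_less_cancel_right atLeastLessThan_iff imageE le_less_trans
          less_nat_zero_code linorder_not_less min.cobounded2 subsetD)
  qed
  from bad consider (between) a b where "a \<in> A" "b \<in> A" "0 < a" "a < w" "w < b"
    | (above) b where "b \<in> A" "b < w" "w < 2 * b" unfolding maj_bad_def by blast
  then show False
  proof cases
    case between
    \<comment> \<open>The windows of width \<open>a\<close> cover the first \<open>w\<close>
      columns, which the disjunction detects. From column \<open>b\<close> on, past the end of every
      window, the conjunction is false.\<close>
    let ?s = "w - a"
    let ?T = "\<lambda>j. {x. if x \<in> T then min (h x) ?s \<le> j \<and> j < min (h x) ?s + a else j < b}"
    have bk: "b \<le> k" using A between by auto
    have "card {j. j < k \<and> F (?T j)} \<noteq> w"
    proof (rule avoids_familyD[OF av])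
      fix x
      have "{j. j < k \<and> x \<in> ?T j} = (if x \<in> T then {min (h x) ?s..<min (h x) ?s + a} else {..<b})"
        using bk between by auto
      then show "card {j. j < k \<and> x \<in> ?T j} \<in> A" using between by simp
    qed
    moreover have "F (?T j) \<longleftrightarrow> j < w" for j
    proof -
      have "F (?T j) \<longleftrightarrow> (if j < b then j < ?s + a else
          (\<forall>x\<in>T. min (h x) ?s \<le> j \<and> j < min (h x) ?s + a))"
        using win[of a ?s j] between bk by (simp add: minimal_true_threshold[OF F])
      then show ?thesis using between ne by auto
    qed
    ultimately show False using between bk by (simp add: Collect_less_and)
  next
    case above
    \<comment> \<open>All rows of \<open>T\<close> contain columns \<open>b\<close> to
      \<open>w - 1\<close>, so the conjunction holds there. The remaining weight
      \<open>2 * b - w\<close>, positive by assumption, forms windows that cover the first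
      \<open>b\<close> columns.\<close>
    let ?s = "w - b"
    let ?a = "b - ?s"
    let ?T = "\<lambda>j. {x. if x \<in> T then b \<le> j \<and> j < w \<or> min (h x) ?s \<le> j \<and> j < min (h x) ?s + ?a
      else j < b}"
    have "card {j. j < k \<and> F (?T j)} \<noteq> w"
    proof (rule avoids_familyD[OF av])
      fix x
      have "{j. j < k \<and> x \<in> ?T j} =
          (if x \<in> T then {min (h x) ?s..<min (h x) ?s + ?a} \<union> {b..<w} else {..<b})"
        using A above by auto
      moreover have "card ({min (h x) ?s..<min (h x) ?s + ?a} \<union> {b..<w}) = ?a + ?s"
        using above by (subst card_Un_disjoint) auto
      ultimately show "card {j. j < k \<and> x \<in> ?T j} \<in> A" using above by simp
    qed
    moreover have "F (?T j) \<longleftrightarrow> j < w" for j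
    proof -
      have "?s < k" using above A by simp
      then have "j < b \<Longrightarrow> \<exists>x\<in>T. min (h x) ?s \<le> j \<and> j < min (h x) ?s + ?a"
        using win[of ?a ?s j] above by simp
      then show ?thesis using above ne by (auto simp: minimal_true_threshold[OF F])
    qed
    ultimately show False using above A by (simp add: Collect_less_and)
  qed
qed

subsection \<open>Failure of AT forces parity on disjoint true sets\<close>

text \<open>Up to duality, every failure of \<open>AT\<close> has one of these shapes, by
  \<open>at_bad_of_realizes\<close>. The extreme output \<open>w = k\<close> comes with two weights
  because rows of equal weight cannot produce it outside \<open>A\<close>.\<close>

definition at_bad :: "nat \<Rightarrow> nat set \<Rightarrow> nat \<Rightarrow> bool" where
  "at_bad k A w \<longleftrightarrow> (\<exists>a\<in>A. 0 < a \<and> a < w \<and> w < k) \<or> (w = k \<and> (\<exists>a\<in>A. \<exists>b\<in>A. a < b \<and> b < k))"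

lemma length_filter_singletons:
  "distinct ys \<Longrightarrow> length (filter (\<lambda>T. i \<in> T) (map (\<lambda>y. {y}) ys)) = of_bool (i \<in> set ys)"
  by (induction ys) auto

lemma filter_singletons:
  "\<forall>y\<in>set ys. F {y} \<Longrightarrow> filter F (map (\<lambda>y. {y}) ys) = map (\<lambda>y. {y}) ys"
  by (induction ys) auto

text \<open>The columns are constant sets, true singletons from \<open>Y\<close>, and sets built
  from \<open>X\<close> and \<open>Y\<close>, arranged so that all row weights are admissible. The
  forbidden output then ties \<open>F (X \<union> Y)\<close> to \<open>F X\<close>.\<close>

lemma at_bad_rules:
  fixes F :: "'a set \<Rightarrow> bool"
  assumes F: "self_dual F" "\<not> F {}" and av: "avoids F k A w" and bad: "at_bad k A w"
    and A: "A \<subseteq> {..k}"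
  obtains g where "0 < g" "g \<le> k"
    "\<And>X Y. finite Y \<Longrightarrow> X \<inter> Y = {} \<Longrightarrow> \<forall>y\<in>Y. F {y} \<Longrightarrow> card Y = g \<Longrightarrow> F (X \<union> Y) = (\<not> F X)"
    "\<And>X Y. finite Y \<Longrightarrow> X \<inter> Y = {} \<Longrightarrow> \<forall>y\<in>Y. F {y} \<Longrightarrow> card Y = g - 1 \<Longrightarrow> F X \<Longrightarrow> F (X \<union> Y)"
proof -
  have U: "F UNIV" using F unfolding self_dual_def by (metis Compl_empty_eq)
  have neg: "F (- X) = (\<not> F X)" for X using F by (simp add: self_dual_def)
  have neg_Un: "F (- X \<inter> - Y) = (\<not> F (X \<union> Y))" for X Y using neg[of "X \<union> Y"] by simp
  note cnt = length_filter_singletons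
  from bad consider (single) a where "a \<in> A" "0 < a" "a < w" "w < k"
    | (double) a b where "w = k" "a \<in> A" "b \<in> A" "a < b" "b < k" unfolding at_bad_def by blast
  then show thesis
  proof cases
    case single
    define g where "g = w - a"
    \<comment> \<open>Every row has weight \<open>a\<close>: besides the \<open>a - 1\<close> full
      columns, each element lies in exactly one of \<open>X\<close>, a singleton of
      \<open>Y\<close>, or the complement of \<open>X \<union> Y\<close>.\<close>
    have key: "of_bool (\<not> F (X \<union> Y)) + (a - 1) + card Y + of_bool (F X) \<noteq> w"
      if Y: "finite Y" "X \<inter> Y = {}" "\<forall>y\<in>Y. F {y}" "card Y \<le> g" for X Y :: "'a set"
    proof -
      obtain ys where ys: "set ys = Y" "distinct ys" using finite_distinct_list[OF Y(1)] by blast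
      have len: "length ys = card Y" using ys distinct_card by fastforce
      let ?Ts = "[- (X \<union> Y)] @ replicate (a - 1) UNIV @ map (\<lambda>y. {y}) ys @ [X]
        @ replicate (k - a - card Y - 1) {}"
      have "length (filter F ?Ts) \<noteq> w"
      proof (rule avoidsD[OF av])
        show "length ?Ts = k" using single Y(4) by (simp add: len g_def)
        fix i
        have "length (filter (\<lambda>T. i \<in> T) ?Ts) = a"
          unfolding filter_append length_append cnt[OF ys(2)] using single Y(2) ys by auto
        then show "length (filter (\<lambda>T. i \<in> T) ?Ts) \<in> A" using single by simp
      qed
      moreover have "length (filter F ?Ts) = of_bool (\<not> F (X \<union> Y)) + (a - 1) + card Y + of_bool (F X)"
        unfolding filter_append length_append using Y(3) ys
        by (subst filter_singletons) (auto simp: U F(2) neg neg_Un len)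
      ultimately show ?thesis by simp
    qed
    show thesis
    proof (rule that[of g])
      show "0 < g" "g \<le> k" using single by (auto simp: g_def)
      fix X Y :: "'a set"
      assume Y: "finite Y" "X \<inter> Y = {}" "\<forall>y\<in>Y. F {y}"
      \<comment> \<open>With \<open>g\<close> singletons the two indicator terms of
        \<open>key\<close> cannot add up to 1; with \<open>g - 1\<close> they cannot add up to
        2.\<close>
      show "F (X \<union> Y) = (\<not> F X)" if "card Y = g"
        using key[OF Y] that single by (cases "F X"; cases "F (X \<union> Y)") (auto simp: g_def)
      show "F (X \<union> Y)" if "card Y = g - 1" "F X"
        using key[OF Y] that single diff_le_self[of g 1] by (cases "F (X \<union> Y)") (auto simp: g_def)
    qed
  next
    case double
    \<comment> \<open>The all-true output is forbidden, so the columns are chosen to be all true if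
      the claim failed. For the flip rule, \<open>a\<close> columns are full, \<open>g\<close> are
      singletons, and the other \<open>e\<close> separate row weight \<open>a\<close> from
      \<open>b\<close>.\<close>
    define g where "g = k - b"
    define e where "e = b - a"
    have bge: "b = a + e" "k = a + e + g" "0 < e" "0 < g" using double by (auto simp: g_def e_def)
    show thesis
    proof (rule that[of g])
      show "0 < g" "g \<le> k" using bge by auto
      fix X Y :: "'a set"
      assume Y: "finite Y" "X \<inter> Y = {}" "\<forall>y\<in>Y. F {y}"
      obtain ys where ys: "set ys = Y" "distinct ys" using finite_distinct_list[OF Y(1)] by blast
      have len: "length ys = card Y" using ys distinct_card by fastforce
      have fs: "filter F (map (\<lambda>y. {y}) ys) = map (\<lambda>y. {y}) ys"
        using Y(3) ys by (intro filter_singletons) auto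
      show "F (X \<union> Y) = (\<not> F X)" if c: "card Y = g"
      proof (cases "F X")
        case False
        let ?Ts = "[- (X \<union> Y)] @ replicate (e - 1) (- X) @ replicate a UNIV @ map (\<lambda>y. {y}) ys"
        have "length (filter F ?Ts) \<noteq> w"
        proof (rule avoidsD[OF av])
          show "length ?Ts = k" using bge by (simp add: len c)
          fix i
          have "length (filter (\<lambda>T. i \<in> T) ?Ts) = (if i \<in> X then a else b)"
            unfolding filter_append length_append cnt[OF ys(2)] using bge Y(2) ys by auto
          then show "length (filter (\<lambda>T. i \<in> T) ?Ts) \<in> A" using double by simp
        qed
        moreover have "length (filter F ?Ts) = k" if "\<not> F (X \<union> Y)"
          unfolding filter_append length_append fs using False bge that
          by (auto simp: U F(2) neg neg_Un len c)
        ultimately show ?thesis using double False by auto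
      next
        case True
        let ?Ts = "replicate a UNIV @ [X] @ replicate (e - 1) (X \<union> Y) @ map (\<lambda>y. {y}) ys"
        have "length (filter F ?Ts) \<noteq> w"
        proof (rule avoidsD[OF av])
          show "length ?Ts = k" using bge by (simp add: len c)
          fix i
          have "length (filter (\<lambda>T. i \<in> T) ?Ts) = (if i \<in> X \<union> Y then b else a)"
            unfolding filter_append length_append cnt[OF ys(2)] using bge Y(2) ys by auto
          then show "length (filter (\<lambda>T. i \<in> T) ?Ts) \<in> A" using double by simp
        qed
        moreover have "length (filter F ?Ts) = k" if "F (X \<union> Y)"
          unfolding filter_append length_append fs using True bge that
          by (auto simp: U F(2) neg neg_Un len c)
        ultimately show ?thesis using double True by auto
      qed
      show "F (X \<union> Y)" if c: "card Y = g - 1" "F X"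
      proof -
        \<comment> \<open>All rows now have weight \<open>b\<close>; using one singleton fewer
          leaves a column for \<open>X\<close>.\<close>
        let ?Ts = "[- (X \<union> Y)] @ replicate (b - 1) UNIV @ [X] @ map (\<lambda>y. {y}) ys"
        have "length (filter F ?Ts) \<noteq> w"
        proof (rule avoidsD[OF av])
          show "length ?Ts = k" using bge by (simp add: len c)
          fix i
          have "length (filter (\<lambda>T. i \<in> T) ?Ts) = b"
            unfolding filter_append length_append cnt[OF ys(2)] using bge Y(2) ys by auto
          then show "length (filter (\<lambda>T. i \<in> T) ?Ts) \<in> A" using double by simp
        qed
        moreover have "length (filter F ?Ts) = k" if "\<not> F (X \<union> Y)"
          unfolding filter_append length_append fs using bge that c
          by (auto simp: U F(2) neg neg_Un len)
        ultimately show ?thesis using double by auto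
      qed
    qed
  qed
qed

text \<open>For \<open>g = 1\<close>, flipping is parity at once. Otherwise the two rules are
  combined modulo \<open>2 * g\<close>: even \<open>g\<close> is contradictory, and odd
  \<open>g\<close> lets two atoms be added without changing the value. The size of \<open>At\<close>
  supplies the atoms used for padding.\<close>

lemma parity_of_rules:
  fixes F :: "'a set \<Rightarrow> bool"
  assumes At: "finite At" "\<And>t. t \<in> At \<Longrightarrow> F {t}" and F0: "\<not> F {}" and g: "0 < g"
    and flip: "\<And>X Y. X \<subseteq> At \<Longrightarrow> Y \<subseteq> At \<Longrightarrow> X \<inter> Y = {} \<Longrightarrow> card Y = g \<Longrightarrow> F (X \<union> Y) = (\<not> F X)"
    and keep: "\<And>X Y. X \<subseteq> At \<Longrightarrow> Y \<subseteq> At \<Longrightarrow> X \<inter> Y = {} \<Longrightarrow> card Y = g - 1 \<Longrightarrow> F X \<Longrightarrow> F (X \<union> Y)"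
    and X: "X \<subseteq> At" "card X + g\<^sup>2 + 2 \<le> card At"
  shows "F X \<longleftrightarrow> odd (card X)"
proof -
  have fin: "finite Y" if "Y \<subseteq> At" for Y using that At(1) finite_subset by blast
  have fresh: "\<exists>Z\<subseteq>At. Z \<inter> Y = {} \<and> card Z = n" if "Y \<subseteq> At" "card Y + n \<le> card At" for Y n
  proof -
    have "n \<le> card (At - Y)" using that At(1) by (simp add: card_Diff_subset fin)
    then obtain Z where "Z \<subseteq> At - Y" "card Z = n" by (rule obtain_subset_with_card_n)
    then show ?thesis by blast
  qed
  have split: "\<exists>Y1 Y2. Y = Y1 \<union> Y2 \<and> Y1 \<inter> Y2 = {} \<and> card Y1 = m \<and> card Y2 = n"
    if "Y \<subseteq> At" "card Y = m + n" for Y m n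
  proof -
    have "m \<le> card Y" using that by simp
    then obtain Y1 where "Y1 \<subseteq> Y" "card Y1 = m" by (rule obtain_subset_with_card_n)
    moreover have "card (Y - Y1) = n"
      using \<open>Y1 \<subseteq> Y\<close> \<open>card Y1 = m\<close> that by (simp add: card_Diff_subset fin finite_subset[OF \<open>Y1 \<subseteq> Y\<close>])
    ultimately show ?thesis by (intro exI[of _ Y1] exI[of _ "Y - Y1"]) auto
  qed
  have flips: "F (X \<union> Y) = (F X \<noteq> odd q)"
    if "X \<subseteq> At" "Y \<subseteq> At" "X \<inter> Y = {}" "card Y = q * g" for X Y q
    using that
  proof (induction q arbitrary: Y)
    case 0
    then show ?case using fin by auto
  next
    case (Suc q)
    then obtain Y1 Y2 where Y: "Y = Y1 \<union> Y2" "Y1 \<inter> Y2 = {}" "card Y1 = q * g" "card Y2 = g"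
      using split[of Y "q * g" g] by (auto simp: algebra_simps)
    have "F (X \<union> Y1) = (F X \<noteq> odd q)" using Suc Y by (intro Suc.IH) auto
    moreover have "F ((X \<union> Y1) \<union> Y2) = (\<not> F (X \<union> Y1))" using Suc.prems Y by (intro flip) auto
    ultimately show ?case using Y by (auto simp: Un_assoc)
  qed
  have keeps: "F (X \<union> Y)"
    if "X \<subseteq> At" "Y \<subseteq> At" "X \<inter> Y = {}" "card Y = q * (g - 1)" "F X" for X Y q
    using that
  proof (induction q arbitrary: Y)
    case 0
    then show ?case using fin by auto
  next
    case (Suc q)
    then obtain Y1 Y2 where Y: "Y = Y1 \<union> Y2" "Y1 \<inter> Y2 = {}" "card Y1 = q * (g - 1)" "card Y2 = g - 1"
      using split[of Y "q * (g - 1)" "g - 1"] by (metis add.commute mult_Suc)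
    have "F (X \<union> Y1)" using Suc Y by (intro Suc.IH) auto
    then have "F ((X \<union> Y1) \<union> Y2)"
      using keep[of "X \<union> Y1" Y2] Suc.prems(1-3) Y by auto
    then show ?case using Y by (auto simp: Un_assoc)
  qed
  \<comment> \<open>Adding atoms keeps a true set true when their number is congruent to a multiple of g - 1
    modulo 2 g. For even g this includes 1, which contradicts flip; for odd g it includes 2.\<close>
  have keep_mod: "F (X \<union> Y)"
    if XY: "X \<subseteq> At" "Y \<subseteq> At" "X \<inter> Y = {}" "F X" "card Y + 2 * p * g = q * (g - 1)"
      "card X + q * (g - 1) \<le> card At" for X Y p q
  proof -
    have "card (X \<union> Y) + 2 * p * g \<le> card At"
      using XY fin by (subst card_Un_disjoint) auto
    then obtain Z where Z: "Z \<subseteq> At" "Z \<inter> (X \<union> Y) = {}" "card Z = 2 * p * g"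
      using fresh[of "X \<union> Y" "2 * p * g"] XY by auto
    have "card (Y \<union> Z) = q * (g - 1)" using XY Z fin by (subst card_Un_disjoint) auto
    then have "F (X \<union> (Y \<union> Z))" using XY Z by (intro keeps) auto
    moreover have "F ((X \<union> Y) \<union> Z) = F (X \<union> Y)"
      using flips[of "X \<union> Y" Z "2 * p"] XY(1,2) Z by (simp add: Int_commute)
    ultimately show ?thesis by (simp add: Un_assoc)
  qed
  have "g = 1 \<or> even g \<or> odd g \<and> 3 \<le> g" using g by presburger
  then consider "g = 1" | "even g" | "odd g" "3 \<le> g" by blast
  then show ?thesis
  proof cases
    case 1
    then show ?thesis using flips[of "{}" X "card X"] X F0 by simp
  next
    case 2
    \<comment> \<open>Here \<open>(g - 1) * (g - 1) = 1 + 2 * h * g\<close>, so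
      \<open>keep_mod\<close> can add a single atom. Adding \<open>g - 1\<close> atoms and then one
      more to \<open>{x}\<close> keeps it true, against \<open>flip\<close>.\<close>
    then obtain h where h: "g = 2 * h + 2" using g by (cases "g div 2") (auto elim!: evenE)
    have "0 < card At" using X by simp
    then obtain x where x: "x \<in> At" by fastforce
    have big: "2 + g * g \<le> card At" using X by (simp add: power2_eq_square)
    then have "card {x} + g \<le> card At" using g by (simp add: h)
    then obtain Y where Y: "Y \<subseteq> At" "Y \<inter> {x} = {}" "card Y = g" using fresh[of "{x}" g] x by auto
    then obtain Y1 Y2 where Y12: "Y = Y1 \<union> Y2" "Y1 \<inter> Y2 = {}" "card Y1 = g - 1" "card Y2 = 1"
      using split[of Y "g - 1" 1] g by auto
    have "F ({x} \<union> Y1)" using keep[of "{x}" Y1] x Y Y12 At(2) by auto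
    moreover have "card ({x} \<union> Y1) = g" using Y Y12 fin g by (subst card_Un_disjoint) auto
    moreover have "1 + 2 * h * g = (g - 1) * (g - 1)" "g + (g - 1) * (g - 1) \<le> card At"
      using big by (auto simp: h algebra_simps)
    ultimately have "F (({x} \<union> Y1) \<union> Y2)"
      using keep_mod[of "{x} \<union> Y1" Y2 h "g - 1"] x Y Y12 by auto
    moreover have "F ({x} \<union> Y) = (\<not> F {x})" using x Y by (intro flip) auto
    ultimately show ?thesis using x At(2) Y12 by (auto simp: Un_assoc)
  next
    case 3
    then obtain h where h: "g = 2 * h + 3"
      by (metis add.commute le_Suc_ex even_add odd_numeral evenE)
    \<comment> \<open>The witnesses come from
      \<open>2 + 2 * h * g = (g - 2) * (g - 1)\<close>.\<close>
    have two: "F (X \<union> Y)" if "X \<subseteq> At" "Y \<subseteq> At" "X \<inter> Y = {}" "card Y = 2" "F X"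
        "card X + g + g * (g - 2) \<le> card At" for X Y
      using that by (intro keep_mod[of _ _ h "g - 2"]) (auto simp: h algebra_simps)
    have gg: "g + g * (g - 2) + g = g\<^sup>2" by (simp add: h power2_eq_square algebra_simps)
    have two': "F (X \<union> Y) = F X" if XY: "X \<subseteq> At" "Y \<subseteq> At" "X \<inter> Y = {}" "card Y = 2"
        "card X + g\<^sup>2 + 2 \<le> card At" for X Y
    proof (cases "F X")
      case True
      then show ?thesis using two[of X Y] XY gg by auto
    next
      case False
      \<comment> \<open>A false \<open>X\<close> becomes true after adding \<open>g\<close> fresh
        atoms; two atoms are added there, and the flip is then undone.\<close>
      have "card (X \<union> Y) + g \<le> card At" using XY fin gg by (subst card_Un_disjoint) auto
      then obtain Z where Z: "Z \<subseteq> At" "Z \<inter> (X \<union> Y) = {}" "card Z = g"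
        using fresh[of "X \<union> Y" g] XY by auto
      have "X \<inter> Z = {}" using Z by blast
      then have "F (X \<union> Z)" using flip[of X Z] XY Z False by auto
      moreover have "card (X \<union> Z) = card X + g" using XY Z fin by (subst card_Un_disjoint) auto
      moreover have "(X \<union> Z) \<inter> Y = {}" using XY Z by blast
      ultimately have "F ((X \<union> Z) \<union> Y)" using two[of "X \<union> Z" Y] XY Z gg by auto
      moreover have "F ((X \<union> Y) \<union> Z) = (\<not> F (X \<union> Y))" using XY Z by (intro flip) auto
      ultimately show ?thesis using False by (simp add: Un_ac)
    qed
    show ?thesis using X
    proof (induction "card X" arbitrary: X rule: less_induct)
      case less
      consider "card X = 0" | "card X = 1" | n where "card X = n + 2"
        by (metis One_nat_def add_2_eq_Suc' not0_implies_Suc)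
      then show ?case
      proof cases
        case 1
        then show ?thesis using less.prems fin F0 by auto
      next
        case 2
        then show ?thesis using less.prems At(2) by (auto simp: card_1_singleton_iff)
      next
        case 3
        then obtain Y1 Y2 where Y: "X = Y1 \<union> Y2" "Y1 \<inter> Y2 = {}" "card Y1 = n" "card Y2 = 2"
          using split[of X n 2] less.prems by auto
        have "F (Y1 \<union> Y2) = F Y1" using less.prems Y 3 by (intro two') auto
        moreover have "F Y1 = odd (card Y1)" using less.prems Y 3 by (intro less.hyps) auto
        ultimately show ?thesis using Y 3 by simp
      qed
    qed
  qed
qed

subsection \<open>Failure of parity\<close>

text \<open>Repeating a row of weight \<open>p\<close> gives an output of the right parity; pairs of
  rows of the nonconstant weight \<open>m\<close> can then correct it two columns at a time.\<close>

definition par_bad :: "nat \<Rightarrow> nat set \<Rightarrow> nat \<Rightarrow> bool" where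
  "par_bad k A w \<longleftrightarrow> (\<exists>m\<in>A. 0 < m \<and> m < k) \<and> (\<exists>p\<in>A. even p = even w)"

text \<open>The common part \<open>Z t\<close> of a pair cancels modulo 2, leaving two neighbouring
  points; the pairs together leave an interval.\<close>

lemma paired_sets_parity:
  fixes j l :: nat
  assumes "\<And>t. C (2 * t) = insert (l + 2 * t) (Z t)"
    and "\<And>t. C (2 * t + 1) = insert (l + 2 * t + 1) (Z t)"
    and "\<And>t. t < q \<Longrightarrow> l + 2 * t \<notin> Z t \<and> l + 2 * t + 1 \<notin> Z t"
  shows "odd (card {i. i < 2 * q \<and> j \<in> C i}) \<longleftrightarrow> l \<le> j \<and> j < l + 2 * q"
  using assms(3)
proof (induction q)
  case (Suc q)
  have *: "{i. i < 2 * Suc q \<and> j \<in> C i} = {i. i < 2 * q \<and> j \<in> C i} \<union>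
      ({2 * q} \<inter> {i. j \<in> C i}) \<union> ({2 * q + 1} \<inter> {i. j \<in> C i})"
    by (auto simp: less_Suc_eq)
  have "card {i. i < 2 * Suc q \<and> j \<in> C i} = card {i. i < 2 * q \<and> j \<in> C i} +
      of_bool (j \<in> C (2 * q)) + of_bool (j \<in> C (2 * q + 1))"
    unfolding * by (subst card_Un_disjoint; force?)+
  moreover have "odd (card {i. i < 2 * q \<and> j \<in> C i}) \<longleftrightarrow> l \<le> j \<and> j < l + 2 * q"
    using Suc by simp
  moreover have "j \<in> Z q \<Longrightarrow> j \<noteq> l + 2 * q \<and> j \<noteq> l + 2 * q + 1"
    using Suc.prems[of q] by auto
  ultimately show ?case
    using assms(1)[of q] assms(2)[of q] by (cases "j \<in> Z q") auto
qed simp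

text \<open>All rows from \<open>2 * q\<close> on are \<open>{..<p}\<close>, which alone would give
  \<open>p\<close> true columns. The \<open>q\<close> pairs before them toggle exactly the columns
  between \<open>p\<close> and \<open>w\<close>, so the output becomes
  \<open>{..<w}\<close>.\<close>

lemma par_bad_contradiction:
  fixes F :: "nat set \<Rightarrow> bool"
  assumes F: "self_dual F" and par: "\<And>X. X \<subseteq> {..<k} \<Longrightarrow> F X \<longleftrightarrow> odd (card X)"
    and av: "avoids F k A w" and A: "A \<subseteq> {..k}" "w \<le> k" and bad: "par_bad k A w"
  shows False
proof -
  obtain m p where m: "m \<in> A" "0 < m" "m < k" and p: "p \<in> A" "even p = even w"
    using bad unfolding par_bad_def by blast
  have pk: "p \<le> k" using A p by auto
  define l where "l = min p w"
  define q where "q = (max p w - l) div 2"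
  have "even (max p w - l)" using p(2) by (auto simp: l_def max_def min_def)
  then have q: "l + 2 * q = max p w" by (auto simp: q_def l_def)
  have lq: "l + 2 * q \<le> k" using q pk A by simp
  \<comment> \<open>Leaving out the two toggled columns makes both sets of the pair have exactly
    \<open>m\<close> elements; \<open>m < k\<close> ensures that enough columns remain.\<close>
  have "\<exists>Z. t < q \<longrightarrow> Z \<subseteq> {..<k} - {l + 2 * t, l + 2 * t + 1} \<and> card Z = m - 1" for t
  proof (cases "t < q")
    case True
    then have "card ({..<k} - {l + 2 * t, l + 2 * t + 1}) = k - 2"
      using lq by (subst card_Diff_subset) auto
    then have "m - 1 \<le> card ({..<k} - {l + 2 * t, l + 2 * t + 1})" using m by simp
    then show ?thesis by (metis obtain_subset_with_card_n)
  qed simp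
  then obtain Z where Z: "\<And>t. t < q \<Longrightarrow> Z t \<subseteq> {..<k} - {l + 2 * t, l + 2 * t + 1} \<and> card (Z t) = m - 1"
    by metis
  define C where "C i = insert (l + i) (Z (i div 2))" for i
  have cardC: "card (C i) = m" "C i \<subseteq> {..<k}" if "i < 2 * q" for i
  proof -
    have t: "i div 2 < q" using that by auto
    have "i = 2 * (i div 2) \<or> i = 2 * (i div 2) + 1" by auto
    then have "l + i \<notin> Z (i div 2)" using Z[OF t] by auto
    moreover have "finite (Z (i div 2))" using Z[OF t] finite_subset by blast
    ultimately show "card (C i) = m" using Z[OF t] m by (simp add: C_def)
    show "C i \<subseteq> {..<k}" using Z[OF t] that lq by (auto simp: C_def)
  qed
  have odd_C: "odd (card {i. i < 2 * q \<and> j \<in> C i}) \<longleftrightarrow> l \<le> j \<and> j < l + 2 * q" for j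
    by (rule paired_sets_parity[where Z = Z]) (use Z in \<open>auto simp: C_def\<close>)
  let ?T = "\<lambda>j. {x. if x < 2 * q then j \<in> C x else j < p}"
  have "card {j. j < k \<and> F (?T j)} \<noteq> w"
  proof (rule avoids_familyD[OF av])
    fix x
    have "{j. j < k \<and> x \<in> ?T j} = (if x < 2 * q then C x else {..<p})"
      using pk cardC(2)[of x] by auto
    then show "card {j. j < k \<and> x \<in> ?T j} \<in> A" using cardC(1)[of x] m p by simp
  qed
  moreover have "F (?T j) \<longleftrightarrow> j < w" for j
  proof (cases "j < p")
    case True
    \<comment> \<open>For \<open>j < p\<close> the set is cofinite, so \<open>par\<close> is applied
      to its complement, which lies in the first \<open>2 * q\<close> points; since
      \<open>2 * q\<close> is even, the parity is that of the rows containing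
      \<open>j\<close>.\<close>
    have "F (?T j) = (\<not> F (- ?T j))" using F by (simp add: self_dual_def)
    also have "- ?T j = {..<2 * q} - {i. i < 2 * q \<and> j \<in> C i}" using True by auto
    also have "F \<dots> = odd (card \<dots>)" using lq by (intro par) auto
    also have "card ({..<2 * q} - {i. i < 2 * q \<and> j \<in> C i}) = 2 * q - card {i. i < 2 * q \<and> j \<in> C i}"
      by (subst card_Diff_subset) auto
    also have "odd \<dots> = odd (card {i. i < 2 * q \<and> j \<in> C i})"
      using card_mono[of "{..<2 * q}" "{i. i < 2 * q \<and> j \<in> C i}"] by fastforce
    finally show ?thesis using odd_C[of j] True q by (auto simp: l_def max_def min_def split: if_splits)
  next
    case False
    then have "?T j = {i. i < 2 * q \<and> j \<in> C i}" by auto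
    moreover have "F {i. i < 2 * q \<and> j \<in> C i} = odd (card {i. i < 2 * q \<and> j \<in> C i})"
      using lq by (intro par) auto
    ultimately show ?thesis using odd_C[of j] False q
      by (auto simp: l_def max_def min_def split: if_splits)
  qed
  ultimately show False using A by (simp add: Collect_less_and)
qed

subsection \<open>What a failing column pattern looks like\<close>

lemma length_filter_id_sum: "length (filter id x) = (\<Sum>j<length x. of_bool (x ! j))"
  by (simp add: length_filter_conv_card Int_def)

text \<open>Indicator sums stay sums, so that the double counts below can exchange the order of
  summation.\<close>

declare sum_of_bool_eq [simp del] sum_of_bool_mult_eq [simp del]

lemma realizes_le: "realizes g k A w \<Longrightarrow> w \<le> k"
  unfolding realizes_def using length_filter_le[of _ "[0..<k]"] by auto

lemma realizesE:
  assumes "realizes g k A w"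
  obtains L and r :: "nat \<Rightarrow> nat \<Rightarrow> bool" where "odd L" "\<And>i. i < L \<Longrightarrow> (\<Sum>j<k. of_bool (r i j)) \<in> A"
    "w = card {j. j < k \<and> g (map (\<lambda>i. r i j) [0..<L])}"
proof -
  obtain xs where xs: "odd (length xs)" "\<And>x. x \<in> set xs \<Longrightarrow> length x = k \<and> length (filter id x) \<in> A"
    "w = length (filter (\<lambda>j. g (map (\<lambda>x. x ! j) xs)) [0..<k])"
    using assms unfolding realizes_def by blast
  show thesis
  proof (rule that[of "length xs" "\<lambda>i j. xs ! i ! j"])
    show "(\<Sum>j<k. of_bool (xs ! i ! j)) \<in> A" if "i < length xs" for i
      using xs(2)[OF nth_mem[OF that]] by (metis length_filter_id_sum)
    have "map (\<lambda>x. x ! j) xs = map (\<lambda>i. xs ! i ! j) [0..<length xs]" for j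
      by (rule nth_equalityI) auto
    then show "w = card {j. j < k \<and> g (map (\<lambda>i. xs ! i ! j) [0..<length xs])}"
      using xs(3) by (simp add: length_filter_upt)
  qed (rule xs)
qed

lemma sum_of_bool_card: "finite S \<Longrightarrow> (\<Sum>j\<in>S. of_bool (p j)) = card {j\<in>S. p j}"
  by (simp add: sum_of_bool_eq Int_def)

text \<open>Constant rows make all columns equal, so \<open>g\<close> takes one value on all of
  them.\<close>

lemma constant_rows_output:
  assumes "\<And>i. i < L \<Longrightarrow> (\<Sum>j<k. of_bool (r i j)) \<in> {0, k}"
    and "w = card {j. j < k \<and> g (map (\<lambda>i. r i j) [0..<L])}"
  shows "w = 0 \<or> w = k"
proof -
  have const: "r i j = r i 0" if "i < L" "j < k" for i j
  proof -
    have "{j\<in>{..<k}. r i j} = {} \<or> {j\<in>{..<k}. r i j} = {..<k}"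
    proof (cases "card {j\<in>{..<k}. r i j} = k")
      case True
      then have "{j\<in>{..<k}. r i j} = {..<k}" by (intro card_subset_eq) auto
      then show ?thesis by blast
    next
      case False
      then have "card {j\<in>{..<k}. r i j} = 0"
        using assms(1)[OF that(1)] by (simp add: sum_of_bool_card)
      moreover have "finite {j\<in>{..<k}. r i j}" by simp
      ultimately show ?thesis by (metis card_0_eq)
    qed
    then have "(\<forall>j<k. \<not> r i j) \<or> (\<forall>j<k. r i j)" by auto
    moreover have "0 < k" using that by simp
    ultimately show ?thesis using that(2) by metis
  qed
  have col: "map (\<lambda>i. r i j) [0..<L] = map (\<lambda>i. r i 0) [0..<L]" if "j < k" for j
    by (intro map_cong refl const[OF _ that]) simp
  have "{j. j < k \<and> g (map (\<lambda>i. r i j) [0..<L])} = {j. j < k \<and> g (map (\<lambda>i. r i 0) [0..<L])}"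
    by (intro Collect_cong conj_cong refl arg_cong[of _ _ g] col)
  then show ?thesis using assms(2) by (cases "g (map (\<lambda>i. r i 0) [0..<L])") auto
qed

text \<open>Counting ones modulo 2, \<open>w\<close> is congruent to a sum of an odd number of row
  weights, so some row weight has its parity. If only constant rows were admissible,
  \<open>Par\<close> would reproduce a weight of \<open>A\<close>.\<close>

lemma par_bad_of_realizes:
  assumes "realizes Par k A w" "w \<notin> A" "A \<subseteq> {..k}"
  shows "par_bad k A w"
proof -
  obtain L r where r: "odd L" "\<And>i. i < L \<Longrightarrow> (\<Sum>j<k. of_bool (r i j)) \<in> A"
    "w = card {j. j < k \<and> Par (map (\<lambda>i. r i j) [0..<L])}"
    using realizesE[OF assms(1)] by metis
  have Par: "Par (map (\<lambda>i. r i j) [0..<L]) = odd (\<Sum>i<L. of_bool (r i j) :: nat)" for j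
    unfolding Par_def length_filter_id_sum by simp
  have "even w = even (\<Sum>j<k. of_bool (odd (\<Sum>i<L. of_bool (r i j) :: nat)) :: nat)"
    using r(3) by (simp add: sum_of_bool_card Par)
  also have "\<dots> = even (\<Sum>j<k. \<Sum>i<L. of_bool (r i j) :: nat)"
    by (auto simp: even_sum_iff)
  also have "\<dots> = even (\<Sum>i<L. \<Sum>j<k. of_bool (r i j) :: nat)"
    by (subst sum.swap) simp
  finally have parity: "even w = even (\<Sum>i<L. \<Sum>j<k. of_bool (r i j) :: nat)" .
  have "\<exists>i<L. even (\<Sum>j<k. of_bool (r i j) :: nat) = even w"
  proof (rule ccontr)
    assume *: "\<not> ?thesis"
    then have "{i. i < L \<and> odd (\<Sum>j<k. of_bool (r i j) :: nat)} = (if even w then {..<L} else {})"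
      by auto
    then have "even (\<Sum>i<L. \<Sum>j<k. of_bool (r i j) :: nat) = (\<not> even w)"
      using r(1) by (simp add: even_sum_iff)
    then show False using parity by simp
  qed
  then have 1: "\<exists>p\<in>A. even p = even w" using r(2) by blast
  moreover have "\<exists>m\<in>A. 0 < m \<and> m < k"
  proof (rule ccontr)
    assume "\<not> ?thesis"
    then have Ak: "A \<subseteq> {0, k}" using assms(3) by fastforce
    have w: "w = 0 \<or> w = k" using constant_rows_output[OF _ r(3)] r(2) Ak by blast
    \<comment> \<open>As \<open>w\<close> is 0 or \<open>k\<close> and lies outside
      \<open>A\<close>, all rows are constant of weight \<open>v\<close>. Parity of an odd number of
      equal bits is that bit, which forces \<open>w = v\<close>.\<close>
    define v where "v = k - w"
    have v: "A \<subseteq> {v}" using Ak w assms(2) by (auto simp: v_def)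
    have "r i j = (v = k)" if "i < L" "j < k" for i j
    proof -
      have "card {j\<in>{..<k}. r i j} = v" using r(2)[OF that(1)] v by (auto simp: sum_of_bool_card)
      moreover have "0 < k" using that by simp
      ultimately have "{j\<in>{..<k}. r i j} = (if v = k then {..<k} else {})"
        using w card_subset_eq[of "{..<k}" "{j\<in>{..<k}. r i j}"] by (auto simp: v_def)
      then show ?thesis using that by (auto split: if_splits)
    qed
    then have "{j. j < k \<and> Par (map (\<lambda>i. r i j) [0..<L])} = (if v = k then {..<k} else {})"
      using r(1) by (auto simp: Par)
    then have "w = (if v = k then k else 0)" using r(3) by simp
    then have "w = v" using w by (auto simp: v_def split: if_splits)
    then show False using v 1 assms(2) by auto
  qed
  ultimately show ?thesis by (simp add: par_bad_def)
qed

text \<open>An output strictly between 0 and \<open>k\<close> needs a nonconstant row, and duality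
  decides on which side of \<open>w\<close> its weight may be taken. The outputs 0 and
  \<open>k\<close> are settled by summing the signed column sums.\<close>

lemma at_bad_of_realizes:
  assumes "realizes AT k A w" "w \<notin> A" "A \<subseteq> {..k}"
  shows "at_bad k A w \<or> at_bad k ((-) k ` A) (k - w)"
proof -
  obtain L r where r: "odd L" "\<And>i. i < L \<Longrightarrow> (\<Sum>j<k. of_bool (r i j)) \<in> A"
    "w = card {j. j < k \<and> AT (map (\<lambda>i. r i j) [0..<L])}"
    using realizesE[OF assms(1)] by metis
  define v where "v j = (\<Sum>i<L. (-1::int) ^ i * of_bool (r i j))" for j
  have AT: "AT (map (\<lambda>i. r i j) [0..<L]) = (v j > 0)" for j
    by (simp add: AT_def v_def)
  have w: "w = card {j. j < k \<and> v j > 0}" using r(3) by (simp add: AT)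
  have alt: "(\<Sum>i<L. (-1::int) ^ i) = 1"
    using r(1) by (induction L rule: induct_nat_012) (auto elim: oddE)
  have wk: "w \<le> k" using assms(1) by (rule realizes_le)
  \<comment> \<open>With a common row weight \<open>a\<close> the signed column sums total
    \<open>a\<close>, as the signs add up to 1. Output \<open>k\<close> makes each sum at least 1
    and output 0 makes each nonpositive, so either way \<open>w = a\<close>.\<close>
  have differ: "\<exists>a\<in>A. \<exists>b\<in>A. a < b" if "w = k \<or> w = 0"
  proof (rule ccontr)
    assume *: "\<not> ?thesis"
    define a where "a = (\<Sum>j<k. of_bool (r 0 j) :: nat)"
    have "0 < L" using r(1) by (rule odd_pos)
    then have "a \<in> A" using r(2) by (simp add: a_def)
    then have a: "(\<Sum>j<k. of_bool (r i j)) = a" if "i < L" for i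
      using * r(2)[OF that] by (meson linorder_neqE_nat)
    have "(\<Sum>j<k. v j) = (\<Sum>i<L. \<Sum>j<k. (-1) ^ i * of_bool (r i j))"
      unfolding v_def by (rule sum.swap)
    also have "\<dots> = (\<Sum>i<L. (-1) ^ i * int (\<Sum>j<k. of_bool (r i j)))"
      by (simp add: sum_distrib_left)
    also have "\<dots> = (\<Sum>i<L. (-1) ^ i * int a)" using a by (intro sum.cong) auto
    also have "\<dots> = int a" using alt by (simp flip: sum_distrib_right)
    finally have sum: "(\<Sum>j<k. v j) = int a" .
    have "w = a" using that
    proof
      assume "w = k"
      then have "{j. j < k \<and> v j > 0} = {..<k}" using w by (intro card_subset_eq) auto
      then have "j \<in> {j. j < k \<and> v j > 0}" if "j < k" for j using that by simp
      then have "1 \<le> v j" if "j < k" for j using that by fastforce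
      then have "(\<Sum>j<k. 1) \<le> (\<Sum>j<k. v j)" by (intro sum_mono) simp
      then show "w = a" using sum \<open>w = k\<close> \<open>a \<in> A\<close> assms(3) by fastforce
    next
      assume "w = 0"
      then have "{j. j < k \<and> v j > 0} = {}" using w by simp
      then have "v j \<le> 0" if "j < k" for j using that by (metis (mono_tags, lifting) empty_iff mem_Collect_eq not_le)
      then have "(\<Sum>j<k. v j) \<le> 0" by (intro sum_nonpos) simp
      then show "w = a" using sum \<open>w = 0\<close> by simp
    qed
    then show False using \<open>a \<in> A\<close> assms(2) by simp
  qed
  consider "w = k" | "w = 0" | "0 < w" "w < k" using wk by linarith
  then show ?thesis
  proof cases
    case 1
    then obtain a b where "a \<in> A" "b \<in> A" "a < b" using differ by blast
    moreover have "b < k" using \<open>b \<in> A\<close> assms 1 by (metis atMost_iff le_neq_implies_less subsetD)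
    ultimately show ?thesis using 1 unfolding at_bad_def by blast
  next
    case 2
    then obtain a b where "a \<in> A" "b \<in> A" "a < b" using differ by blast
    moreover have "a \<noteq> 0" using \<open>a \<in> A\<close> assms(2) 2 by metis
    moreover have "b \<le> k" using \<open>b \<in> A\<close> assms(3) by auto
    ultimately have "k - b \<in> (-) k ` A" "k - a \<in> (-) k ` A" "k - b < k - a" "k - a < k" by auto
    then show ?thesis using 2 unfolding at_bad_def by (metis diff_zero)
  next
    case 3
    then obtain i where i: "i < L" "(\<Sum>j<k. of_bool (r i j)) \<notin> {0, k}"
      using constant_rows_output[OF _ r(3)] by (metis less_irrefl)
    define a where "a = (\<Sum>j<k. of_bool (r i j) :: nat)"
    have a: "a \<in> A" "0 < a" "a < k" "a \<noteq> w"
      using i r(2)[OF i(1)] assms by (auto simp: a_def le_less dest: subsetD)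
    show ?thesis
    proof (cases "a < w")
      case True
      then show ?thesis using a 3 by (auto simp: at_bad_def)
    next
      case False
      then have "k - a \<in> (-) k ` A" "0 < k - a" "k - a < k - w" "k - w < k" using a 3 by auto
      then show ?thesis by (auto simp: at_bad_def)
    qed
  qed
qed

text \<open>Double counting: each of \<open>w\<close> columns has at least half of
  \<open>L + 1\<close> ones and each row at most \<open>b\<close>, so
  \<open>w * (L + 1) \<le> 2 * b * L\<close>.\<close>

lemma maj_count:
  fixes b L k w :: nat
  assumes "odd L" "\<And>i. i < L \<Longrightarrow> (\<Sum>j<k. of_bool (r i j)) \<le> b" "0 < w"
    "w \<le> card {j. j < k \<and> L < 2 * (\<Sum>i<L. of_bool (r i j))}"
  shows "w < 2 * b"
proof -
  let ?c = "\<lambda>j. \<Sum>i<L. of_bool (r i j) :: nat"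
  let ?J = "{j. j < k \<and> L < 2 * ?c j}"
  have "w * (L + 1) \<le> card ?J * (L + 1)" using assms(4) by (rule mult_right_mono) simp
  also have "\<dots> = (\<Sum>j\<in>?J. L + 1)" by simp
  also have "\<dots> \<le> (\<Sum>j\<in>?J. 2 * ?c j)" by (intro sum_mono) auto
  also have "\<dots> \<le> (\<Sum>j<k. 2 * ?c j)" by (intro sum_mono2) auto
  also have "\<dots> = 2 * (\<Sum>i<L. \<Sum>j<k. of_bool (r i j))"
    by (subst sum.swap) (simp add: sum_distrib_left)
  also have "\<dots> \<le> 2 * (\<Sum>i<L. b)" using assms(2) by (intro mult_left_mono sum_mono) auto
  finally have "w * L + w \<le> 2 * b * L" by (simp add: algebra_simps)
  then have "w * L < 2 * b * L" using assms(3) by linarith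
  then show ?thesis by simp
qed

text \<open>If \<open>w\<close> exceeds all weights, \<open>maj_count\<close> applies; if it is
  below all of them, it applies to the negated matrix. Otherwise \<open>w\<close> is neither 0 nor
  \<open>k\<close>, so some row is nonconstant and gives the first shape or its dual.\<close>

lemma maj_bad_of_realizes:
  assumes "realizes Maj k A w" "w \<notin> A" "A \<subseteq> {..k}"
  shows "maj_bad A w \<or> maj_bad ((-) k ` A) (k - w)"
proof -
  obtain L r where r: "odd L" "\<And>i. i < L \<Longrightarrow> (\<Sum>j<k. of_bool (r i j)) \<in> A"
    "w = card {j. j < k \<and> Maj (map (\<lambda>i. r i j) [0..<L])}"
    using realizesE[OF assms(1)] by metis
  have Maj: "Maj (map (\<lambda>i. r i j) [0..<L]) \<longleftrightarrow> L < 2 * (\<Sum>i<L. of_bool (r i j))" for j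
    unfolding Maj_def length_filter_id_sum by simp
  have w: "w = card {j. j < k \<and> L < 2 * (\<Sum>i<L. of_bool (r i j))}" using r(3) by (simp add: Maj)
  have wk: "w \<le> k" using assms(1) by (rule realizes_le)
  have finA: "finite A" using assms(3) finite_subset by blast
  have neA: "A \<noteq> {}" using r(1,2) odd_pos by blast
  have compl: "(\<Sum>j\<in>{..<n}. of_bool (\<not> p j) :: nat) = n - (\<Sum>j<n. of_bool (p j))" for n :: nat and p
  proof -
    have "{j \<in> {..<n}. \<not> p j} = {..<n} - {j \<in> {..<n}. p j}" by auto
    moreover have "card ({..<n} - {j \<in> {..<n}. p j}) = n - card {j \<in> {..<n}. p j}"
      by (subst card_Diff_subset) auto
    ultimately show ?thesis by (simp add: sum_of_bool_card)
  qed
  consider (above) "\<forall>a\<in>A. a < w" | (below) "\<forall>a\<in>A. w < a" | (mid) "\<exists>a\<in>A. a < w" "\<exists>b\<in>A. w < b"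
    using assms(2) by (metis linorder_neqE_nat)
  then show ?thesis
  proof cases
    case above
    have M: "Max A \<in> A" "Max A < w" using above finA neA by auto
    have "w < 2 * Max A"
    proof (rule maj_count[OF r(1)])
      show "(\<Sum>j<k. of_bool (r i j)) \<le> Max A" if "i < L" for i using r(2)[OF that] finA by simp
    qed (use M w in auto)
    then show ?thesis using M by (auto simp: maj_bad_def)
  next
    case below
    have M: "Min A \<in> A" "w < Min A" using below finA neA by auto
    then have Mk: "Min A \<le> k" using assms(3) by auto
    have "k - w < 2 * (k - Min A)"
    proof (rule maj_count[OF r(1)])
      show "(\<Sum>j<k. of_bool (\<not> r i j)) \<le> k - Min A" if "i < L" for i
        unfolding compl using r(2)[OF that] finA by (intro diff_le_mono2) simp
      \<comment> \<open>Since \<open>L\<close> is odd, no column is tied.\<close>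
      have "L < 2 * (\<Sum>i<L. of_bool (\<not> r i j)) \<longleftrightarrow> \<not> L < 2 * (\<Sum>i<L. of_bool (r i j))" for j
      proof -
        have "(\<Sum>i<L. of_bool (r i j)) \<le> (\<Sum>i<L. 1 :: nat)" by (rule sum_mono) auto
        then have "(\<Sum>i<L. of_bool (r i j)) \<le> L" by simp
        then show ?thesis unfolding compl using r(1) by presburger
      qed
      then have "{j. j < k \<and> L < 2 * (\<Sum>i<L. of_bool (\<not> r i j))} =
          {..<k} - {j. j < k \<and> L < 2 * (\<Sum>i<L. of_bool (r i j))}" by auto
      then have "card {j. j < k \<and> L < 2 * (\<Sum>i<L. of_bool (\<not> r i j))} = k - w"
        unfolding w by (simp add: card_Diff_subset subset_eq)
      then show "k - w \<le> card {j. j < k \<and> L < 2 * (\<Sum>i<L. of_bool (\<not> r i j))}" by simp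
    qed (use M Mk in auto)
    moreover have "k - Min A \<in> (-) k ` A" "k - Min A < k - w" using M Mk by auto
    ultimately show ?thesis by (auto simp: maj_bad_def)
  next
    case mid
    then obtain a b where ab: "a \<in> A" "a < w" "b \<in> A" "w < b" by blast
    have bk: "b \<le> k" using ab assms(3) by auto
    have "\<exists>i<L. (\<Sum>j<k. of_bool (r i j)) \<notin> {0, k}"
      using constant_rows_output[OF _ r(3)] ab bk by (metis less_nat_zero_code linorder_not_less)
    then obtain m where m: "m \<in> A" "m \<noteq> 0" "m \<noteq> k" using r(2) by blast
    have mk: "m < k" using m assms(3) by (auto simp: le_less)
    show ?thesis
    proof (cases "m < w")
      case True
      then show ?thesis using m ab by (auto simp: maj_bad_def)
    next
      case False
      then have "w < m" using m assms(2) by (metis linorder_neqE_nat)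
      then have "k - m \<in> (-) k ` A" "k - a \<in> (-) k ` A" "0 < k - m" "k - m < k - w" "k - w < k - a"
        using m ab mk by auto
      then show ?thesis unfolding maj_bad_def by blast
    qed
  qed
qed

subsection \<open>Fixing sets\<close>

text \<open>Collapsing the true sets to points turns them into true singletons. A failure of
  \<open>AT\<close> then makes the collapsed family parity on small sets, which a failure of
  \<open>Par\<close> excludes.\<close>

lemma card_disjoint_true_sets:
  fixes F :: "'a set \<Rightarrow> bool"
  assumes F: "self_dual F" "\<not> F {}"
    and par: "avoids F k1 A1 w1" "realizes Par k1 A1 w1" "A1 \<subseteq> {..k1}"
    and at: "avoids F k2 A2 w2" "realizes AT k2 A2 w2" "A2 \<subseteq> {..k2}"
    and \<T>: "finite \<T>" "pairwise disjnt \<T>" "\<And>T. T \<in> \<T> \<Longrightarrow> F T"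
  shows "card \<T> < k1 + k2\<^sup>2 + 2"
proof (rule ccontr)
  \<comment> \<open>The matrix against parity uses \<open>k1\<close> points; the remaining
    \<open>k2\<^sup>2 + 2\<close> are the spare atoms for \<open>parity_of_rules\<close>, where
    \<open>g \<le> k2\<close>.\<close>
  define M where "M = k1 + k2\<^sup>2 + 2"
  assume "\<not> ?thesis"
  then have "M \<le> card \<T>" by (simp add: M_def)
  moreover obtain e where e: "bij_betw e {0..<card \<T>} \<T>" using ex_bij_betw_nat_finite[OF \<T>(1)] by blast
  ultimately have eT: "e t \<in> \<T>" if "t < M" for t
    using that by (auto simp: bij_betw_def)
  have uniq: "s = t" if "s < M" "t < M" "x \<in> e s" "x \<in> e t" for s t x
  proof -
    have "e s = e t" using \<T>(2) eT[OF that(1)] eT[OF that(2)] that(3,4)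
      by (auto simp: pairwise_def disjnt_iff)
    then show ?thesis using e that \<open>M \<le> card \<T>\<close> by (auto simp: bij_betw_def inj_on_def)
  qed
  \<comment> \<open>The set \<open>e t\<close> goes to the point \<open>t\<close>, everything
    uncovered to the extra point \<open>M\<close>.\<close>
  define h where "h x = (if \<exists>t<M. x \<in> e t then THE t. t < M \<and> x \<in> e t else M)" for x
  have h: "h x = t \<longleftrightarrow> x \<in> e t" if "t < M" for x t
  proof -
    have "h x = s" if "s < M" "x \<in> e s" for s
      unfolding h_def using that uniq by (auto intro!: the_equality)
    moreover have "\<not> (\<exists>t<M. x \<in> e t) \<Longrightarrow> h x = M" unfolding h_def by (rule if_not_P)
    ultimately show ?thesis using \<open>t < M\<close> uniq by (metis less_irrefl)
  qed
  define G where "G Y = F (h -` Y)" for Y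
  have G: "self_dual G" "\<not> G {}" using F by (auto simp: self_dual_def G_def vimage_Compl)
  have atom: "G {t}" if "t < M" for t
  proof -
    have "h -` {t} = e t" using h[OF that] by auto
    then show ?thesis using \<T>(3)[OF eT[OF that]] by (simp add: G_def)
  qed
  have avG: "avoids G k A w" if "avoids F k A w" for k A w
    using avoids_vimage[OF that] by (simp add: G_def[abs_def])
  have "w1 \<le> k1" "w2 \<le> k2" using par(2) at(2) realizes_le by auto
  then have "w1 \<notin> A1" "w2 \<notin> A2" using avoids_notin[OF _ F] par(1) at(1) by auto
  obtain A w where bad: "at_bad k2 A w" "avoids G k2 A w" "A \<subseteq> {..k2}"
  proof -
    have "(-) k2 ` A2 \<subseteq> {..k2}" by auto
    then show thesis
      using at_bad_of_realizes[OF at(2) \<open>w2 \<notin> A2\<close> at(3)] that avG[OF at(1)] at(3)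
        avoids_dual[OF avG[OF at(1)] G(1) at(3) \<open>w2 \<le> k2\<close>] by blast
  qed
  obtain g where g: "0 < g" "g \<le> k2"
    and flip: "\<And>X Y. finite Y \<Longrightarrow> X \<inter> Y = {} \<Longrightarrow> \<forall>y\<in>Y. G {y} \<Longrightarrow> card Y = g \<Longrightarrow> G (X \<union> Y) = (\<not> G X)"
    and keep: "\<And>X Y. finite Y \<Longrightarrow> X \<inter> Y = {} \<Longrightarrow> \<forall>y\<in>Y. G {y} \<Longrightarrow> card Y = g - 1 \<Longrightarrow> G X \<Longrightarrow> G (X \<union> Y)"
    using at_bad_rules[OF G bad(2,1,3)] by blast
  have "G X \<longleftrightarrow> odd (card X)" if "X \<subseteq> {..<k1}" for X
  proof (rule parity_of_rules[of "{..<M}" G g])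
    have "card X \<le> k1" using card_mono[OF _ that] by simp
    moreover have "g\<^sup>2 \<le> k2\<^sup>2" using g by (simp add: power_mono)
    ultimately show "card X + g\<^sup>2 + 2 \<le> card {..<M}" unfolding M_def card_lessThan by linarith
    show "X \<subseteq> {..<M}" using that by (auto simp: M_def)
    fix X Y assume XY: "X \<subseteq> {..<M}" "Y \<subseteq> {..<M}" "X \<inter> Y = {}"
    have Y: "finite Y" "\<forall>y\<in>Y. G {y}" using XY(2) atom finite_subset by blast+
    show "G (X \<union> Y) = (\<not> G X)" if "card Y = g" using flip[OF Y(1) XY(3) Y(2) that] .
    show "G (X \<union> Y)" if "card Y = g - 1" "G X" using keep[OF Y(1) XY(3) Y(2) that] .
  qed (use atom G g in auto)
  moreover have "par_bad k1 A1 w1" using par_bad_of_realizes[OF par(2) \<open>w1 \<notin> A1\<close> par(3)] .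
  ultimately show False
    using par_bad_contradiction[OF G(1) _ avG[OF par(1)] par(3) \<open>w1 \<le> k1\<close>] by blast
qed

lemma ex_minimal_true_subset:
  assumes "finite X" "F X"
  shows "\<exists>T\<subseteq>X. minimal_true F T"
  using assms
proof (induction X rule: finite_psubset_induct)
  case (psubset X)
  show ?case
  proof (cases "minimal_true F X")
    case False
    then obtain Y where "Y \<subset> X" "F Y" using psubset.prems unfolding minimal_true_def by blast
    then obtain T where "T \<subseteq> Y" "minimal_true F T" using psubset.IH[of Y] by auto
    then show ?thesis using \<open>Y \<subset> X\<close> by (intro exI[of _ T]) auto
  qed blast
qed

text \<open>\<open>S\<close> is the union of a largest family of disjoint minimal true sets. A true
  set missing \<open>S\<close> would contain a further minimal true set and enlarge the
  family.\<close>

lemma ex_hitting_set: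
  fixes F :: "'a set \<Rightarrow> bool"
  assumes F: "self_dual F" "\<not> F {}" and E: "finite E" "\<And>X. F X = F (X \<inter> E)"
    and par: "avoids F k1 A1 w1" "realizes Par k1 A1 w1" "A1 \<subseteq> {..k1}"
    and at: "avoids F k2 A2 w2" "realizes AT k2 A2 w2" "A2 \<subseteq> {..k2}"
    and maj: "avoids F k3 A3 w3" "realizes Maj k3 A3 w3" "A3 \<subseteq> {..k3}"
  shows "\<exists>S\<subseteq>E. card S \<le> (k1 + k2\<^sup>2 + 2) * k3 \<and> (\<forall>X. F X \<longrightarrow> X \<inter> S \<noteq> {})"
proof -
  define \<FF> where "\<FF> = {\<T>. \<T> \<subseteq> Pow E \<and> pairwise disjnt \<T> \<and> (\<forall>T\<in>\<T>. minimal_true F T)}"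
  have "finite \<FF>" using E(1) by (auto simp: \<FF>_def intro: finite_subset[of _ "Pow (Pow E)"])
  moreover have "{} \<in> \<FF>" by (simp add: \<FF>_def)
  ultimately have "Max (card ` \<FF>) \<in> card ` \<FF>" by (intro Max_in) auto
  then obtain \<T> where \<T>: "\<T> \<in> \<FF>" "card \<T> = Max (card ` \<FF>)" by auto
  have max: "card \<T>' \<le> card \<T>" if "\<T>' \<in> \<FF>" for \<T>'
    using that \<T>(2) \<open>finite \<FF>\<close> by simp
  have sub: "\<T> \<subseteq> Pow E" and dis: "pairwise disjnt \<T>" and min: "\<And>T. T \<in> \<T> \<Longrightarrow> minimal_true F T"
    using \<T>(1) by (auto simp: \<FF>_def)
  have fin: "finite \<T>" using sub E(1) by (meson finite_Pow_iff finite_subset)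
  have "card \<T> < k1 + k2\<^sup>2 + 2"
    by (rule card_disjoint_true_sets[OF F par at fin dis]) (use min in \<open>simp add: minimal_true_def\<close>)
  moreover have "card T \<le> k3" if "T \<in> \<T>" for T
  proof -
    have w: "w3 \<le> k3" using maj(2) by (rule realizes_le)
    have "w3 \<notin> A3" using avoids_notin[OF maj(1) F w] .
    then consider "maj_bad A3 w3" | "maj_bad ((-) k3 ` A3) (k3 - w3)"
      using maj_bad_of_realizes[OF maj(2) _ maj(3)] by blast
    moreover have "finite T" using that sub E(1) finite_subset by blast
    moreover have "(-) k3 ` A3 \<subseteq> {..k3}" "k3 - w3 \<le> k3" by auto
    ultimately have "card T < k3"
      using card_minimal_true[OF F(1) min[OF that], of k3] maj w
        avoids_dual[OF maj(1) F(1) maj(3) w] by blast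
    then show ?thesis by simp
  qed
  then have "card (\<Union>\<T>) \<le> card \<T> * k3"
    using card_Union_le_sum_card[of \<T>] sum_bounded_above[of \<T> card k3] by (simp add: le_trans)
  ultimately have "card (\<Union>\<T>) \<le> (k1 + k2\<^sup>2 + 2) * k3"
    by (meson le_trans less_imp_le mult_le_mono1)
  moreover have "X \<inter> \<Union>\<T> \<noteq> {}" if X: "F X" for X
  proof
    assume empty: "X \<inter> \<Union>\<T> = {}"
    obtain T where T: "T \<subseteq> X \<inter> E" "minimal_true F T"
      using ex_minimal_true_subset[of "X \<inter> E" F] E(1) X[unfolded E(2)[of X]] by blast
    \<comment> \<open>Only a nonempty set that is disjoint from the family is sure to be
      new.\<close>
    have "T \<noteq> {}" using T F(2) by (auto simp: minimal_true_def)
    then have "T \<notin> \<T>" using T empty by blast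
    have "insert T \<T> \<in> \<FF>"
      using T sub dis min empty by (auto simp: \<FF>_def pairwise_insert disjnt_def)
    then show False using max \<open>T \<notin> \<T>\<close> fin by fastforce
  qed
  moreover have "\<Union>\<T> \<subseteq> E" using sub by blast
  ultimately show ?thesis by blast
qed

section \<open>From weak polymorphisms to set families\<close>

lemma perm_invariant_same_weight:
  assumes "perm_invariant k P" "x \<in> P" "length x = k" "length y = k"
    "length (filter id x) = length (filter id y)"
  shows "y \<in> P"
proof -
  have len: "length z = count (mset z) True + count (mset z) False" for z :: "bool list"
    by (induction z) auto
  have "count (mset z) True = length (filter id z)" for z
    by (induction z) auto
  then have "count (mset y) b = count (mset x) b" for b
    using assms(3-5) len[of x] len[of y] by (cases b) auto
  then have "mset y = mset x" by (rule multiset_eqI)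
  then obtain p where "p permutes {..<length x}" "permute_list p x = y"
    using mset_eq_permutation by blast
  then show ?thesis
    using assms(1-3) unfolding perm_invariant_def permute_list_def by (auto simp: atLeast0LessThan)
qed

text \<open>By symmetry, weights decide membership: \<open>A\<close> collects the weights in
  \<open>P\<close>, and \<open>w\<close> is the output weight of \<open>g\<close> before the sign is
  applied. The sign \<open>s\<close> covers \<open>g\<close> and its negation at once. The pattern
  is fixed before \<open>L\<close> and \<open>f\<close>, which makes the final bound
  uniform.\<close>

lemma failing_pattern:
  assumes "\<forall>R\<in>\<Gamma>. promise_rel R" "symmetric_fam \<Gamma>" "odd L0" "\<not> weak_pol_fam L0 (\<lambda>x. g x \<noteq> s) \<Gamma>"
  obtains k A w where "A \<subseteq> {..k}" "realizes g k A w"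
    "\<forall>L f. weak_pol_fam L f \<Gamma> \<longrightarrow> avoids (\<lambda>X. f (map (\<lambda>i. i \<in> X) [0..<L]) \<noteq> s) k A w"
proof -
  obtain k P Q where R: "(k, P, Q) \<in> \<Gamma>" "\<not> weak_pol L0 (\<lambda>x. g x \<noteq> s) (k, P, Q)"
    using assms(4) unfolding weak_pol_fam_def by (metis prod_cases3)
  then obtain xs where xs: "length xs = L0" "set xs \<subseteq> P"
    "map (\<lambda>j. g (map (\<lambda>x. x ! j) xs) \<noteq> s) [0..<k] \<notin> Q" unfolding weak_pol_def by auto
  have len: "length x = k" if "x \<in> P" for x
    using assms(1) R(1) that unfolding promise_rel_def by fastforce
  have inv: "perm_invariant k P" "perm_invariant k Q"
    using assms(2) R(1) unfolding symmetric_fam_def by auto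
  define wt where "wt = (\<lambda>x. length (filter id (x :: bool list)))"
  define c where "c j = g (map (\<lambda>x. x ! j) xs)" for j
  \<comment> \<open>Comparison with \<open>s\<close> keeps or complements all entries, so equal
    counts before it give equal weights after it.\<close>
  have wt_neq: "wt (map (\<lambda>j. p j \<noteq> s) js) = (if s then length js - length (filter p js) else length (filter p js))"
    for p and js :: "nat list"
    using sum_length_filter_compl[of p js] by (auto simp: wt_def filter_map o_def)
  show thesis
  proof (rule that[of "wt ` P" k "length (filter c [0..<k])"])
    show "wt ` P \<subseteq> {..k}" using len length_filter_le unfolding wt_def by fastforce
    show "realizes g k (wt ` P) (length (filter c [0..<k]))"
      unfolding realizes_def c_def
      using xs assms(3) len by (intro exI[of _ xs]) (auto simp: wt_def)
    have "avoids (\<lambda>X. f (map (\<lambda>i. i \<in> X) [0..<L]) \<noteq> s) k (wt ` P) (length (filter c [0..<k]))"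
      (is "avoids ?F _ _ _") if pol: "weak_pol_fam L f \<Gamma>" for L f
      unfolding avoids_def
    proof (intro allI impI, elim conjE)
      fix Ts :: "nat set list"
      assume Ts: "length Ts = k" "\<forall>i. length (filter (\<lambda>T. i \<in> T) Ts) \<in> wt ` P"
      have row: "map (\<lambda>T. i \<in> T) Ts \<in> P" for i
      proof -
        obtain x where x: "x \<in> P" "wt x = length (filter (\<lambda>T. i \<in> T) Ts)" using Ts(2) by (metis imageE)
        show ?thesis
          by (rule perm_invariant_same_weight[OF inv(1) x(1) len[OF x(1)]])
            (use x Ts in \<open>simp_all add: wt_def filter_map o_def\<close>)
      qed
      define ys where "ys = map (\<lambda>i. map (\<lambda>T. i \<in> T) Ts) [0..<L]"
      have "weak_pol L f (k, P, Q)" using pol R(1) unfolding weak_pol_fam_def by blast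
      moreover have "length ys = L" "set ys \<subseteq> P" using row by (auto simp: ys_def)
      ultimately have out: "map (\<lambda>j. f (map (\<lambda>y. y ! j) ys)) [0..<k] \<in> Q"
        unfolding weak_pol_def by auto
      have col: "map (\<lambda>j. f (map (\<lambda>y. y ! j) ys)) [0..<k] = map (\<lambda>j. ?F (Ts ! j) \<noteq> s) [0..<k]"
        using Ts(1) by (auto simp: ys_def o_def intro!: arg_cong[of _ _ f])
      have cnt: "length (filter (\<lambda>j. ?F (Ts ! j)) [0..<k]) = length (filter ?F Ts)"
        using Ts(1) by (simp add: length_filter_conv_card cong: conj_cong)
      show "length (filter ?F Ts) \<noteq> length (filter c [0..<k])"
      proof
        \<comment> \<open>The output of \<open>f\<close> lies in \<open>Q\<close> and would have the
          weight of the failing tuple, so symmetry would put that tuple into \<open>Q\<close> as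
          well.\<close>
        assume eq: "length (filter ?F Ts) = length (filter c [0..<k])"
        have "wt (map (\<lambda>j. ?F (Ts ! j) \<noteq> s) [0..<k]) = wt (map (\<lambda>j. c j \<noteq> s) [0..<k])"
          unfolding wt_neq cnt eq ..
        then have "map (\<lambda>j. c j \<noteq> s) [0..<k] \<in> Q"
          using perm_invariant_same_weight[OF inv(2) out[unfolded col]] by (simp add: wt_def)
        then show False using xs(3) by (simp add: c_def)
      qed
    qed
    then show "\<forall>L f. weak_pol_fam L f \<Gamma> \<longrightarrow>
      avoids (\<lambda>X. f (map (\<lambda>i. i \<in> X) [0..<L]) \<noteq> s) k (wt ` P) (length (filter c [0..<k]))" by blast
  qed
qed

lemma fixing_for_sign:
  assumes \<Gamma>: "\<forall>R\<in>\<Gamma>. promise_rel R" "folded_fam \<Gamma>" "symmetric_fam \<Gamma>"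
    and L: "odd L1" "odd L2" "odd L3"
    and fail: "\<not> weak_pol_fam L1 (\<lambda>x. Par x \<noteq> s) \<Gamma>" "\<not> weak_pol_fam L2 (\<lambda>x. AT x \<noteq> s) \<Gamma>"
      "\<not> weak_pol_fam L3 (\<lambda>x. Maj x \<noteq> s) \<Gamma>"
  shows "\<exists>C. \<forall>L f. L \<ge> 1 \<longrightarrow> weak_pol_fam L f \<Gamma> \<longrightarrow> f (replicate L False) = s \<longrightarrow> fixing C L f"
proof -
  obtain k1 A1 w1 where par: "A1 \<subseteq> {..k1}" "realizes Par k1 A1 w1"
    "\<forall>L f. weak_pol_fam L f \<Gamma> \<longrightarrow> avoids (\<lambda>X. f (map (\<lambda>i. i \<in> X) [0..<L]) \<noteq> s) k1 A1 w1"
    by (rule failing_pattern[OF \<Gamma>(1,3) L(1) fail(1)]) (rule that; assumption)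
  obtain k2 A2 w2 where at: "A2 \<subseteq> {..k2}" "realizes AT k2 A2 w2"
    "\<forall>L f. weak_pol_fam L f \<Gamma> \<longrightarrow> avoids (\<lambda>X. f (map (\<lambda>i. i \<in> X) [0..<L]) \<noteq> s) k2 A2 w2"
    by (rule failing_pattern[OF \<Gamma>(1,3) L(2) fail(2)]) (rule that; assumption)
  obtain k3 A3 w3 where maj: "A3 \<subseteq> {..k3}" "realizes Maj k3 A3 w3"
    "\<forall>L f. weak_pol_fam L f \<Gamma> \<longrightarrow> avoids (\<lambda>X. f (map (\<lambda>i. i \<in> X) [0..<L]) \<noteq> s) k3 A3 w3"
    by (rule failing_pattern[OF \<Gamma>(1,3) L(3) fail(3)]) (rule that; assumption)
  show ?thesis
  proof (intro exI[of _ "(k1 + k2\<^sup>2 + 2) * k3"] allI impI)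
    fix L f assume f: "L \<ge> 1" "weak_pol_fam L f \<Gamma>" "f (replicate L False) = s"
    have fold: "folded_fun L f" using \<Gamma>(2) f unfolding folded_fam_def by blast
    \<comment> \<open>Comparison with \<open>s\<close> normalizes the family to be false at the
      empty set.\<close>
    define F where "F X = (f (map (\<lambda>i. i \<in> X) [0..<L]) \<noteq> s)" for X :: "nat set"
    have av: "avoids F k1 A1 w1" "avoids F k2 A2 w2" "avoids F k3 A3 w3"
      using par(3)[rule_format, OF f(2)] at(3)[rule_format, OF f(2)] maj(3)[rule_format, OF f(2)]
      unfolding F_def[abs_def] .
    have dual: "self_dual F" unfolding self_dual_def
    proof
      fix X :: "nat set"
      have "map (\<lambda>i. i \<in> - X) [0..<L] = map Not (map (\<lambda>i. i \<in> X) [0..<L])" by simp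
      moreover have "f (map Not (map (\<lambda>i. i \<in> X) [0..<L])) = (\<not> f (map (\<lambda>i. i \<in> X) [0..<L]))"
        using fold unfolding folded_fun_def by (metis length_map length_upt diff_zero)
      ultimately show "F (- X) = (\<not> F X)" unfolding F_def by metis
    qed
    have empty: "\<not> F {}" using f(3) by (simp add: F_def map_replicate_const)
    have support: "F X = F (X \<inter> {0..<L})" for X
    proof -
      have "map (\<lambda>i. i \<in> X) [0..<L] = map (\<lambda>i. i \<in> X \<inter> {0..<L}) [0..<L]" by simp
      then show ?thesis unfolding F_def by metis
    qed
    obtain S where S: "S \<subseteq> {0..<L}" "card S \<le> (k1 + k2\<^sup>2 + 2) * k3"
        "\<And>X. F X \<Longrightarrow> X \<inter> S \<noteq> {}"
      using ex_hitting_set[OF dual empty finite_atLeastLessThan support av(1) par(2,1)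
          av(2) at(2,1) av(3) maj(2,1)] by blast
    \<comment> \<open>An input vanishing on \<open>S\<close> encodes a set that misses
      \<open>S\<close>, hence a false one, and so has value \<open>s\<close>.\<close>
    have "f x = f (replicate L False)" if x: "length x = L" "\<forall>i\<in>S. x ! i = False" for x
    proof -
      have "\<not> F {i. i < L \<and> x ! i}" using S(3)[of "{i. i < L \<and> x ! i}"] x(2) by blast
      moreover have "map (\<lambda>i. i \<in> {i. i < L \<and> x ! i}) [0..<L] = x"
        using x(1) by (intro nth_equalityI) auto
      ultimately show ?thesis using f(3) by (simp add: F_def)
    qed
    then show "fixing ((k1 + k2\<^sup>2 + 2) * k3) L f"
      using fold S(1,2) unfolding fixing_def by blast
  qed
qed

theorem theorem4p12:
  fixes \<Gamma> :: "prel set"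
  assumes "finite \<Gamma>"
    and "\<forall>R\<in>\<Gamma>. promise_rel R"
    and "folded_fam \<Gamma>"
    and "symmetric_fam \<Gamma>"
    and "\<exists>L1 L2 L3 L4 L5 L6. odd L1 \<and> odd L2 \<and> odd L3 \<and> odd L4 \<and> odd L5 \<and> odd L6 \<and>
           \<not> weak_pol_fam L1 Par \<Gamma> \<and> \<not> weak_pol_fam L2 AT \<Gamma> \<and> \<not> weak_pol_fam L3 Maj \<Gamma> \<and>
           \<not> weak_pol_fam L4 (\<lambda>x. \<not> Par x) \<Gamma> \<and> \<not> weak_pol_fam L5 (\<lambda>x. \<not> AT x) \<Gamma> \<and>
           \<not> weak_pol_fam L6 (\<lambda>x. \<not> Maj x) \<Gamma>"
  shows "\<exists>C::nat. \<forall>L f. L \<ge> 1 \<longrightarrow> weak_pol_fam L f \<Gamma> \<longrightarrow> fixing C L f"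
proof -
  obtain L1 L2 L3 L4 L5 L6 where L: "odd L1" "odd L2" "odd L3" "odd L4" "odd L5" "odd L6"
    and fail: "\<not> weak_pol_fam L1 Par \<Gamma>" "\<not> weak_pol_fam L2 AT \<Gamma>" "\<not> weak_pol_fam L3 Maj \<Gamma>"
      "\<not> weak_pol_fam L4 (\<lambda>x. \<not> Par x) \<Gamma>" "\<not> weak_pol_fam L5 (\<lambda>x. \<not> AT x) \<Gamma>"
      "\<not> weak_pol_fam L6 (\<lambda>x. \<not> Maj x) \<Gamma>"
    using assms(5) by (elim exE conjE) (rule that; assumption)
  \<comment> \<open>The sign \<open>False\<close> uses \<open>Par\<close>, \<open>AT\<close> and
    \<open>Maj\<close>, the sign \<open>True\<close> their negations; the sum of the two constants
    bounds both cases.\<close>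
  obtain C0 where C0: "\<And>L f. L \<ge> 1 \<Longrightarrow> weak_pol_fam L f \<Gamma> \<Longrightarrow> f (replicate L False) = False \<Longrightarrow> fixing C0 L f"
    using fixing_for_sign[OF assms(2-4) L(1-3), of False] fail by auto
  obtain C1 where C1: "\<And>L f. L \<ge> 1 \<Longrightarrow> weak_pol_fam L f \<Gamma> \<Longrightarrow> f (replicate L False) = True \<Longrightarrow> fixing C1 L f"
    using fixing_for_sign[OF assms(2-4) L(4-6), of True] fail by auto
  have mono: "fixing (C0 + C1) L f" if small: "fixing C L f" "C \<le> C0 + C1" for C L f
  proof -
    obtain S where "folded_fun L f" "S \<subseteq> {0..<L}" "card S \<le> C"
      "\<forall>x. length x = L \<and> (\<forall>i\<in>S. x ! i = False) \<longrightarrow> f x = f (replicate L False)"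
      using small(1) unfolding fixing_def by blast
    moreover have "card S \<le> C0 + C1" using \<open>card S \<le> C\<close> small(2) by (rule le_trans)
    ultimately show ?thesis unfolding fixing_def by blast
  qed
  show ?thesis
  proof (intro exI[of _ "C0 + C1"] allI impI)
    fix L f assume f: "L \<ge> 1" "weak_pol_fam L f \<Gamma>"
    show "fixing (C0 + C1) L f"
    proof (cases "f (replicate L False)")
      case True
      show ?thesis by (rule mono[OF C1[OF f]]) (simp_all add: True)
    next
      case False
      show ?thesis by (rule mono[OF C0[OF f]]) (simp_all add: False)
    qed
  qed
qed

end
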